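(* Use the setting and notation of the context (stationary Navier-Stokes equations). Let $r(\theta,\psi)$ be the discrete residual and $L(\theta,\psi)=\frac12\|r(\theta,\psi)\|_{\ell^2}^2$ the discretized loss. Let $G(\theta,\psi)$ be the Gauss-Newton Gram matrix in which the integrals over $\Omega$ and $\partial\Omega$ are discretized with the same quadrature points (and weights) as in $L$. Then $$G(\theta,\psi)=J(\theta,\psi)^T J(\theta,\psi),$$ where $J(\theta,\psi)$ is the Jacobian of $r$ at $(\theta,\psi)$. Consequently the update direction $G(\theta,\psi)^\dagger\nabla L(\theta,\psi)$ of the discretized function-space Gauss-Newton algorithm agrees with the update direction $(J^TJ)^\dagger J^Tr$ of Gauss-Newton's method in parameter space applied to $\min_{\theta,\psi}\frac12\|r(\theta,\psi)\|_{\ell^2}^2$.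
   Context: Let $\Omega\subset\mathbb R^d$, $d\in\{2,3\}$, be a bounded domain, $\nu>0$, with given $f:\Omega\to\mathbb R^d$ and boundary data $g_{bd}:\partial\Omega\to\mathbb R^d$. Let $u_\theta$ ($\mathbb R^d$-valued, $\theta\in\mathbb R^{p_\Theta}$) and $p_\psi$ (scalar, $\psi\in\mathbb R^{p_\Psi}$) be neural networks, smooth jointly in the spatial variable and the parameters. Let $x_1,\dots,x_N\in\Omega$ and $x^b_1,\dots,x^b_{N_{\partial\Omega}}\in\partial\Omega$ be quadrature points. **Discrete residual.** $r(\theta,\psi)$ is the vector obtained by stacking the following entries (vector-valued entries contribute all their components): - $\frac1{\sqrt N}\big(-\nu\Delta u_\theta+(u_\theta\cdot\nabla)u_\theta+\nabla p_\psi-f\big)(x_i)$, $i=1,\dots,N$; - $\frac1{\sqrt N}\operatorname{div}(u_\theta)(x_i)$, $i=1,\dots,N$; - $\frac1{\sqrt{N_{\partial\Omega}}}(u_\theta-g_{bd})(x^b_i)$, $i=1,\dots,N_{\partial\Omega}$. **Gram matrix.** For a velocity direction $\delta_u$ put $N_\theta(\delta_u)=-\nu\Delta\delta_u+(\delta_u\cdot\nabla)u_\theta+(u_\theta\cdot\nabla)\delta_u$. The Gauss-Newton form on pairs (velocity direction, pressure direction) is $$g((\delta_u,\delta_p),(\bar\delta_u,\bar\delta_p))=\big(N_\theta(\delta_u)+\nabla\delta_p,N_\theta(\bar\delta_u)+\nabla\bar\delta_p\big)_\Omega+(\operatorname{div}\delta_u,\operatorname{div}\bar\delta_u)_\Omega+(\delta_u,\bar\delta_u)_{\partial\Omega}.$$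 Its discretization replaces $(a,b)_\Omega$ by $\frac1N\sum_{i=1}^Na(x_i)\cdot b(x_i)$ and $(a,b)_{\partial\Omega}$ by $\frac1{N_{\partial\Omega}}\sum_{i=1}^{N_{\partial\Omega}}a(x^b_i)\cdot b(x^b_i)$. $G(\theta,\psi)$ is the Gram matrix of this discretized form with respect to the ordered family $(\partial_{\theta_1}u_\theta,0),\dots,(\partial_{\theta_{p_\Theta}}u_\theta,0),(0,\partial_{\psi_1}p_\psi),\dots,(0,\partial_{\psi_{p_\Psi}}p_\psi)$. $\dagger$ denotes the Moore-Penrose pseudoinverse. *)

theory Defs
  imports "HOL-Analysis.Analysis"
begin

subsection \<open>Smoothness\<close>

text \<open>
  On an open subset of a finite-dimensional space \<open>Ck_on k\<close> is the usual class of \<open>k\<close> times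
  continuously differentiable functions, expressed through iterated directional derivatives.
\<close>

primrec Ck_on ::
    "nat \<Rightarrow> 'a::real_normed_vector set \<Rightarrow> ('a \<Rightarrow> 'b::real_normed_vector) \<Rightarrow> bool" where
  "Ck_on 0 S f \<longleftrightarrow> continuous_on S f"
| "Ck_on (Suc k) S f \<longleftrightarrow>
     (\<forall>x\<in>S. f differentiable (at x)) \<and> (\<forall>v. Ck_on k S (\<lambda>x. frechet_derivative f (at x) v))"

definition smooth_on :: "'a::real_normed_vector set \<Rightarrow> ('a \<Rightarrow> 'b::real_normed_vector) \<Rightarrow> bool" where
  "smooth_on S f \<longleftrightarrow> (\<forall>k. Ck_on k S f)"


subsection \<open>Differential operators\<close>

definition partial_deriv :: "'k::finite \<Rightarrow> (real^'k \<Rightarrow> 'b::real_normed_vector) \<Rightarrow> real^'k \<Rightarrow> 'b" where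
  "partial_deriv j h y = vector_derivative (\<lambda>t. h (y + t *\<^sub>R axis j 1)) (at 0)"

definition grad :: "(real^'k::finite \<Rightarrow> real) \<Rightarrow> real^'k \<Rightarrow> real^'k" where
  "grad h y = (\<chi> j. partial_deriv j h y)"

definition divergence :: "(real^'d::finite \<Rightarrow> real^'d) \<Rightarrow> real^'d \<Rightarrow> real" where
  "divergence v y = (\<Sum>j\<in>UNIV. partial_deriv j (\<lambda>z. v z $ j) y)"

definition laplacian :: "(real^'d::finite \<Rightarrow> 'b::real_normed_vector) \<Rightarrow> real^'d \<Rightarrow> 'b" where
  "laplacian v y = (\<Sum>j\<in>UNIV. partial_deriv j (partial_deriv j v) y)"

text \<open>\<open>convect a v\<close> is the convective term \<open>(a \<cdot> \<nabla>) v\<close>.\<close>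

definition convect ::
    "(real^'d::finite \<Rightarrow> real^'d) \<Rightarrow> (real^'d \<Rightarrow> 'b::real_normed_vector) \<Rightarrow> real^'d \<Rightarrow> 'b" where
  "convect a v y = (\<Sum>j\<in>UNIV. (a y $ j) *\<^sub>R partial_deriv j v y)"


subsection \<open>Discrete residual and loss\<close>

text \<open>
  The parameter pair \<open>(\<theta>, \<psi>)\<close> is one vector over the sum of the two index types, and the
  residual is a vector over the sum of the index types of its three blocks. The quadrature points
  are families over finite types, so their numbers are \<open>CARD('n)\<close> and \<open>CARD('b)\<close>.
\<close>

definition theta_part :: "real^('p::finite + 'q::finite) \<Rightarrow> real^'p" where
  "theta_part w = (\<chi> i. w $ Inl i)"

definition psi_part :: "real^('p::finite + 'q::finite) \<Rightarrow> real^'q" where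
  "psi_part w = (\<chi> i. w $ Inr i)"

definition ns_operator ::
    "real \<Rightarrow> (real^'d::finite \<Rightarrow> real^'d) \<Rightarrow> (real^'d \<Rightarrow> real) \<Rightarrow> real^'d \<Rightarrow> real^'d" where
  "ns_operator \<nu> v q y = - \<nu> *\<^sub>R laplacian v y + convect v v y + grad q y"

definition residual ::
    "real \<Rightarrow> (real^'d::finite \<Rightarrow> real^'d) \<Rightarrow> (real^'d \<Rightarrow> real^'d) \<Rightarrow>
     (real^'p::finite \<Rightarrow> real^'d \<Rightarrow> real^'d) \<Rightarrow> (real^'q::finite \<Rightarrow> real^'d \<Rightarrow> real) \<Rightarrow>
     ('n::finite \<Rightarrow> real^'d) \<Rightarrow> ('b::finite \<Rightarrow> real^'d) \<Rightarrow>
     real^('p + 'q) \<Rightarrow> real^(('n \<times> 'd) + 'n + ('b \<times> 'd))" where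
  "residual \<nu> f gbd u p x xb w =
     (let v = u (theta_part w); q = p (psi_part w) in
      \<chi> k. case k of
        Inl (i, c) \<Rightarrow> 1 / sqrt (real CARD('n)) * ((ns_operator \<nu> v q (x i) - f (x i)) $ c)
      | Inr (Inl i) \<Rightarrow> 1 / sqrt (real CARD('n)) * divergence v (x i)
      | Inr (Inr (i, c)) \<Rightarrow> 1 / sqrt (real CARD('b)) * ((v (xb i) - gbd (xb i)) $ c))"

definition loss ::
    "real \<Rightarrow> (real^'d::finite \<Rightarrow> real^'d) \<Rightarrow> (real^'d \<Rightarrow> real^'d) \<Rightarrow>
     (real^'p::finite \<Rightarrow> real^'d \<Rightarrow> real^'d) \<Rightarrow> (real^'q::finite \<Rightarrow> real^'d \<Rightarrow> real) \<Rightarrow>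
     ('n::finite \<Rightarrow> real^'d) \<Rightarrow> ('b::finite \<Rightarrow> real^'d) \<Rightarrow> real^('p + 'q) \<Rightarrow> real" where
  "loss \<nu> f gbd u p x xb w = 1 / 2 * (norm (residual \<nu> f gbd u p x xb w))\<^sup>2"


subsection \<open>Discretized Gauss-Newton form and its Gram matrix\<close>

definition ns_linearized ::
    "real \<Rightarrow> (real^'d::finite \<Rightarrow> real^'d) \<Rightarrow> (real^'d \<Rightarrow> real^'d) \<Rightarrow> real^'d \<Rightarrow> real^'d" where
  "ns_linearized \<nu> v \<delta> y = - \<nu> *\<^sub>R laplacian \<delta> y + convect \<delta> v y + convect v \<delta> y"

definition quad_inner ::
    "('i::finite \<Rightarrow> 'x) \<Rightarrow> ('x \<Rightarrow> 'c::real_inner) \<Rightarrow> ('x \<Rightarrow> 'c) \<Rightarrow> real" where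
  "quad_inner x a b = 1 / real CARD('i) * (\<Sum>i\<in>UNIV. a (x i) \<bullet> b (x i))"

definition gauss_newton_form ::
    "real \<Rightarrow> (real^'d::finite \<Rightarrow> real^'d) \<Rightarrow> ('n::finite \<Rightarrow> real^'d) \<Rightarrow> ('b::finite \<Rightarrow> real^'d) \<Rightarrow>
     (real^'d \<Rightarrow> real^'d) \<times> (real^'d \<Rightarrow> real) \<Rightarrow> (real^'d \<Rightarrow> real^'d) \<times> (real^'d \<Rightarrow> real) \<Rightarrow> real" where
  "gauss_newton_form \<nu> v x xb =
     (\<lambda>(\<delta>u, \<delta>p) (\<epsilon>u, \<epsilon>p).
        quad_inner x (\<lambda>y. ns_linearized \<nu> v \<delta>u y + grad \<delta>p y)
                     (\<lambda>y. ns_linearized \<nu> v \<epsilon>u y + grad \<epsilon>p y)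
      + quad_inner x (divergence \<delta>u) (divergence \<epsilon>u)
      + quad_inner xb \<delta>u \<epsilon>u)"

definition tangent ::
    "(real^'p::finite \<Rightarrow> real^'d::finite \<Rightarrow> real^'d) \<Rightarrow> (real^'q::finite \<Rightarrow> real^'d \<Rightarrow> real) \<Rightarrow>
     real^('p + 'q) \<Rightarrow> 'p + 'q \<Rightarrow> (real^'d \<Rightarrow> real^'d) \<times> (real^'d \<Rightarrow> real)" where
  "tangent u p w k =
     (case k of
        Inl i \<Rightarrow> (\<lambda>y. partial_deriv i (\<lambda>\<theta>. u \<theta> y) (theta_part w), \<lambda>y. 0)
      | Inr j \<Rightarrow> (\<lambda>y. 0, \<lambda>y. partial_deriv j (\<lambda>\<psi>. p \<psi> y) (psi_part w)))"

definition gram_matrix :: "('v \<Rightarrow> 'v \<Rightarrow> real) \<Rightarrow> ('k::finite \<Rightarrow> 'v) \<Rightarrow> real^'k^'k" where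
  "gram_matrix B \<phi> = (\<chi> k l. B (\<phi> k) (\<phi> l))"

definition gauss_newton_gram ::
    "real \<Rightarrow>
     (real^'p::finite \<Rightarrow> real^'d::finite \<Rightarrow> real^'d) \<Rightarrow> (real^'q::finite \<Rightarrow> real^'d \<Rightarrow> real) \<Rightarrow>
     ('n::finite \<Rightarrow> real^'d) \<Rightarrow> ('b::finite \<Rightarrow> real^'d) \<Rightarrow>
     real^('p + 'q) \<Rightarrow> real^('p + 'q)^('p + 'q)" where
  "gauss_newton_gram \<nu> u p x xb w =
     gram_matrix (gauss_newton_form \<nu> (u (theta_part w)) x xb) (tangent u p w)"


subsection \<open>Moore-Penrose pseudoinverse\<close>

definition is_moore_penrose :: "real^'n::finite^'m::finite \<Rightarrow> real^'m^'n \<Rightarrow> bool" where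
  "is_moore_penrose A X \<longleftrightarrow>
     A ** X ** A = A \<and> X ** A ** X = X \<and>
     transpose (A ** X) = A ** X \<and> transpose (X ** A) = X ** A"

definition moore_penrose :: "real^'n::finite^'m::finite \<Rightarrow> real^'m^'n" where
  "moore_penrose A = (THE X. is_moore_penrose A X)"

lemma is_moore_penrose_unique:
  assumes X: "is_moore_penrose A X" and Y: "is_moore_penrose A Y"
  shows "X = Y"
proof -
  have AX: "A ** X = A ** Y"
  proof -
    have "A ** X = transpose (A ** Y ** (A ** X))"
      using X Y unfolding is_moore_penrose_def by (metis matrix_mul_assoc)
    also have "\<dots> = A ** X ** (A ** Y)"
      using X Y unfolding is_moore_penrose_def by (metis matrix_transpose_mul)
    also have "\<dots> = A ** Y"
      using X unfolding is_moore_penrose_def by (metis matrix_mul_assoc)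
    finally show ?thesis .
  qed
  have XA: "X ** A = Y ** A"
  proof -
    have "X ** A = transpose (X ** A ** (Y ** A))"
      using X Y unfolding is_moore_penrose_def by (metis matrix_mul_assoc)
    also have "\<dots> = Y ** A ** (X ** A)"
      using X Y unfolding is_moore_penrose_def by (metis matrix_transpose_mul)
    also have "\<dots> = Y ** A"
      using X unfolding is_moore_penrose_def by (metis matrix_mul_assoc)
    finally show ?thesis .
  qed
  have "X = X ** (A ** X)"
    using X by (simp add: is_moore_penrose_def matrix_mul_assoc)
  also have "\<dots> = Y ** A ** Y"
    using AX XA by (simp add: matrix_mul_assoc)
  also have "\<dots> = Y"
    using Y by (simp add: is_moore_penrose_def)
  finally show ?thesis .
qed

lemma transpose_eq_if_selfadjoint:
  fixes M :: "real^'k::finite^'k"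
  assumes "\<And>x y. (M *v x) \<bullet> y = x \<bullet> (M *v y)"
  shows "transpose M = M"
proof -
  have "transpose M *v x = M *v x" for x
  proof -
    have "(transpose M *v x) \<bullet> y = (M *v x) \<bullet> y" for y
      using assms[of x y] by (metis dot_lmul_matrix transpose_matrix_vector)
    then show ?thesis
      by (metis vector_eq_rdot)
  qed
  then show ?thesis
    by (simp add: matrix_eq)
qed

lemma is_moore_penrose_exists:
  fixes A :: "real^'n::finite^'m::finite"
  shows "\<exists>X. is_moore_penrose A X"
proof -
  let ?At = "transpose A"
  note transpose_matrix_vector [simp del]
  define V where "V = range (\<lambda>z. ?At *v z)"
  define R where "R = range (\<lambda>z. A *v z)"
  have subV: "subspace V" and subR: "subspace R"
    unfolding V_def R_def
    by (rule linear_subspace_image[OF matrix_vector_mul_linear subspace_UNIV])+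
  have adj: "(?At *v y) \<bullet> z = y \<bullet> (A *v z)" for y z
    by (simp add: dot_lmul_matrix transpose_matrix_vector)
  have inj: "a = b" if "a \<in> V" "b \<in> V" "A *v a = A *v b" for a b
  proof -
    from that subV have "a - b \<in> V" by (simp add: subspace_diff)
    then obtain z where z: "a - b = ?At *v z" by (auto simp: V_def)
    have "(a - b) \<bullet> (a - b) = z \<bullet> (A *v (a - b))" by (subst (1) z) (rule adj)
    also have "\<dots> = 0" using that by (simp add: matrix_vector_mult_diff_distrib)
    finally show ?thesis by simp
  qed
  have normal: "A *v a = A *v b" if "?At *v (A *v a) = ?At *v (A *v b)" for a b
  proof -
    have "(A *v (a - b)) \<bullet> (A *v (a - b)) = (?At *v (A *v (a - b))) \<bullet> (a - b)"
      by (simp only: adj)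
    also have "\<dots> = 0" using that by (simp add: matrix_vector_mult_diff_distrib)
    finally have "A *v (a - b) = 0" by simp
    then show ?thesis by (simp add: matrix_vector_mult_diff_distrib)
  qed
  have ex: "\<exists>a\<in>V. ?At *v (A *v a) = ?At *v y" for y
  proof -
    obtain b c where b: "b \<in> span R" and c: "\<And>w. w \<in> span R \<Longrightarrow> orthogonal c w" and y: "y = b + c"
      using orthogonal_subspace_decomp_exists by metis
    from b subR obtain s where s: "b = A *v s" by (metis R_def imageE span_eq_iff)
    obtain a k where a: "a \<in> span V" and k: "\<And>w. w \<in> span V \<Longrightarrow> orthogonal k w" and sk: "s = a + k"
      using orthogonal_subspace_decomp_exists by metis
    have "?At *v (A *v k) \<in> span V" by (auto simp: V_def intro: span_base)
    then have "k \<bullet> (?At *v (A *v k)) = 0" using k by (simp add: orthogonal_def)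
    then have "(A *v k) \<bullet> (A *v k) = 0" by (metis adj inner_commute)
    then have Ak: "A *v k = 0" by simp
    have "(?At *v c) \<bullet> z = 0" for z
    proof -
      have "A *v z \<in> span R" by (auto simp: R_def intro: span_base)
      then have "c \<bullet> (A *v z) = 0" using c by (simp add: orthogonal_def)
      then show ?thesis by (simp only: adj)
    qed
    then have "?At *v c = 0" by (metis inner_eq_zero_iff)
    then have "?At *v (A *v a) = ?At *v y"
      using y s sk Ak by (simp add: matrix_vector_right_distrib)
    moreover have "a \<in> V" using a subV by (metis span_eq_iff)
    ultimately show ?thesis by blast
  qed
  then obtain h where hV: "\<And>y. h y \<in> V" and h: "\<And>y. ?At *v (A *v h y) = ?At *v y"
    by metis
  have uniq: "h y = a" if "a \<in> V" "?At *v (A *v a) = ?At *v y" for a y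
    by (rule inj) (use that hV h normal in auto)
  have "linear h"
  proof (rule linearI)
    show "h (a + b) = h a + h b" for a b
      by (rule uniq) (use hV h subV in \<open>auto simp: subspace_add matrix_vector_right_distrib\<close>)
    show "h (c *\<^sub>R a) = c *\<^sub>R h a" for c a
      by (rule uniq) (use hV h subV in \<open>auto simp: subspace_scale matrix_vector_mult_scaleR\<close>)
  qed
  then have mh: "matrix h *v y = h y" for y
    by (metis matrix_vector_mul(2))
  have AhA: "A *v h (A *v y) = A *v y" for y
    by (rule normal) (rule h)
  have hAh: "h (A *v h y) = h y" for y
    by (rule uniq) (use hV in auto)
  have "is_moore_penrose A (matrix h)"
    unfolding is_moore_penrose_def
  proof (intro conjI)
    show "A ** matrix h ** A = A"
      by (simp add: matrix_eq mh AhA flip: matrix_vector_mul_assoc)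
    show "matrix h ** A ** matrix h = matrix h"
      by (simp add: matrix_eq mh hAh flip: matrix_vector_mul_assoc)
    show "transpose (A ** matrix h) = A ** matrix h"
    proof (rule transpose_eq_if_selfadjoint)
      fix y z
      have "(A *v h y) \<bullet> z = (A *v h y) \<bullet> (A *v h z)" for y z
        by (metis adj h inner_commute)
      then have "(A *v h y) \<bullet> z = y \<bullet> (A *v h z)"
        by (metis inner_commute)
      then show "(A ** matrix h *v y) \<bullet> z = y \<bullet> (A ** matrix h *v z)"
        by (simp add: mh flip: matrix_vector_mul_assoc)
    qed
    show "transpose (matrix h ** A) = matrix h ** A"
    proof (rule transpose_eq_if_selfadjoint)
      fix y z
      have "h (A *v y) \<bullet> z = h (A *v y) \<bullet> h (A *v z)" for y z
      proof -
        obtain s where "h (A *v y) = ?At *v s" using hV by (auto simp: V_def)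
        then show ?thesis by (simp only: adj AhA)
      qed
      then have "h (A *v y) \<bullet> z = y \<bullet> h (A *v z)"
        by (metis inner_commute)
      then show "(matrix h ** A *v y) \<bullet> z = y \<bullet> (matrix h ** A *v z)"
        by (simp add: mh flip: matrix_vector_mul_assoc)
    qed
  qed
  then show ?thesis ..
qed

lemma is_moore_penrose_moore_penrose: "is_moore_penrose A (moore_penrose A)"
  unfolding moore_penrose_def
  by (rule theI') (metis is_moore_penrose_exists is_moore_penrose_unique)

end

theory Submission
  imports Defs
begin

text \<open>
  Everything follows from one identity: the derivative of the residual in a parameter direction
  is the linearized operator, evaluated at the quadrature points, of the derivative of the
  networks in that direction. For the parameter direction \<open>k\<close> the derivative of the networks is
  \<open>tangent u p w k\<close>, so with \<open>S\<close> the map \<open>stacked_linearization\<close>, which evaluates the linearized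
  equations at a direction and stacks the weighted values, column \<open>k\<close> of the Jacobian \<open>J\<close> is
  \<open>S (tangent u p w k)\<close>. The weights \<open>1 / sqrt N\<close> are chosen so that the discretized form is the
  pullback of the Euclidean inner product, \<open>g (a, b) = S a \<bullet> S b\<close> (\<open>gauss_newton_form_eq_inner\<close>).
  Hence the Gram matrix is \<open>J\<^sup>T J\<close>; and \<open>\<nabla>L = J\<^sup>T r\<close> by the chain rule, so the two update directions
  are the same pseudoinverse applied to the same vector.

  In the identity (\<open>residual_has_derivative\<close>) the convective term contributes by the product
  rule. The substance is that a parameter derivative may be moved inside the spatial derivatives
  \<open>\<Delta>\<close>, \<open>\<nabla>\<close> and \<open>div\<close>. This is the symmetry of second derivatives of
  \<open>(w, y) \<mapsto> u w y\<close> as a function on the product of parameter space and physical space, taken in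
  the directions \<open>(e, 0)\<close> and \<open>(0, d)\<close>. The symmetry is proved first
  (\<open>mixed_derivatives_commute\<close>), then transferred to families of functions depending smoothly on
  a parameter (\<open>smooth_family_derivs_commute\<close>).

  Velocity and pressure parameters need no separate treatment: both networks are regarded as
  families over the joint parameter \<open>w\<close>, the velocity being \<open>w \<mapsto> u (theta_part w)\<close>. A network
  is constant along the other network's coordinates, which reproduces the zeros in the
  tangent family.
\<close>

section \<open>Symmetry of second derivatives\<close>

text \<open>
  The mean value theorem in direction \<open>v\<close>, for the difference of \<open>f\<close> along two opposite sides of
  the parallelogram, followed by the mean value theorem in direction \<open>w\<close>. Exchanging \<open>v\<close> and \<open>w\<close>
  leaves the double difference on the left unchanged, and this is where the symmetry of second
  derivatives comes from.
\<close>

lemma double_difference_mean_value: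
  fixes f :: "'a::real_normed_vector \<Rightarrow> real"
  assumes s: "0 < s"
    and box: "\<And>a b. 0 \<le> a \<Longrightarrow> a \<le> s \<Longrightarrow> 0 \<le> b \<Longrightarrow> b \<le> s \<Longrightarrow> x + a *\<^sub>R v + b *\<^sub>R w \<in> S"
    and f: "\<And>y. y \<in> S \<Longrightarrow> (f has_derivative f' y) (at y)"
    and fv: "\<And>y. y \<in> S \<Longrightarrow> ((\<lambda>y. f' y v) has_derivative fv' y) (at y)"
  shows "\<exists>a b. 0 < a \<and> a < s \<and> 0 < b \<and> b < s \<and>
           f (x + s *\<^sub>R v + s *\<^sub>R w) - f (x + s *\<^sub>R v) - f (x + s *\<^sub>R w) + f x
             = s * s * fv' (x + a *\<^sub>R v + b *\<^sub>R w) w"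
proof -
  have line: "((\<lambda>a. x + a *\<^sub>R v + c *\<^sub>R w) has_derivative (\<lambda>t. t *\<^sub>R v)) (at a)"
    "((\<lambda>b. x + c *\<^sub>R v + b *\<^sub>R w) has_derivative (\<lambda>t. t *\<^sub>R w)) (at a)" for a c
    by (auto intro!: derivative_eq_intros)
  have across: "((\<lambda>a. f (x + a *\<^sub>R v + s *\<^sub>R w) - f (x + a *\<^sub>R v + 0 *\<^sub>R w)) has_derivative
      (\<lambda>t. f' (x + a *\<^sub>R v + s *\<^sub>R w) (t *\<^sub>R v) - f' (x + a *\<^sub>R v + 0 *\<^sub>R w) (t *\<^sub>R v))) (at a)"
    if "0 \<le> a" "a \<le> s" for a
    by (intro has_derivative_diff has_derivative_compose[OF line(1) f] box) (use that s in simp_all)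
  obtain a where a: "0 < a" "a < s" and eq1:
    "f (x + s *\<^sub>R v + s *\<^sub>R w) - f (x + s *\<^sub>R v + 0 *\<^sub>R w)
       - (f (x + 0 *\<^sub>R v + s *\<^sub>R w) - f (x + 0 *\<^sub>R v + 0 *\<^sub>R w))
     = f' (x + a *\<^sub>R v + s *\<^sub>R w) ((s - 0) *\<^sub>R v) - f' (x + a *\<^sub>R v + 0 *\<^sub>R w) ((s - 0) *\<^sub>R v)"
    using mvt_simple[OF s has_derivative_at_withinI[OF across]] by auto
  have up: "((\<lambda>b. f' (x + a *\<^sub>R v + b *\<^sub>R w) v) has_derivative
      (\<lambda>t. fv' (x + a *\<^sub>R v + b *\<^sub>R w) (t *\<^sub>R w))) (at b)" if "0 \<le> b" "b \<le> s" for b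
    by (intro has_derivative_compose[OF line(2) fv] box) (use that a in simp_all)
  obtain b where b: "0 < b" "b < s" and eq2:
    "f' (x + a *\<^sub>R v + s *\<^sub>R w) v - f' (x + a *\<^sub>R v + 0 *\<^sub>R w) v
     = fv' (x + a *\<^sub>R v + b *\<^sub>R w) ((s - 0) *\<^sub>R w)"
    using mvt_simple[OF s has_derivative_at_withinI[OF up]] by auto
  have lin: "linear (f' (x + a *\<^sub>R v + c *\<^sub>R w))" "linear (fv' (x + a *\<^sub>R v + c *\<^sub>R w))"
    if "0 \<le> c" "c \<le> s" for c
    using f[THEN has_derivative_linear] fv[THEN has_derivative_linear] box[of a c] that a by auto
  have "f (x + s *\<^sub>R v + s *\<^sub>R w) - f (x + s *\<^sub>R v) - f (x + s *\<^sub>R w) + f x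
      = s * (f' (x + a *\<^sub>R v + s *\<^sub>R w) v - f' (x + a *\<^sub>R v + 0 *\<^sub>R w) v)"
    using eq1 lin(1)[of s] lin(1)[of 0] s by (simp add: linear_cmul algebra_simps)
  also have "\<dots> = s * s * fv' (x + a *\<^sub>R v + b *\<^sub>R w) w"
    unfolding eq2 using lin(2)[of b] b by (simp add: linear_cmul)
  finally show ?thesis
    using a b by blast
qed

text \<open>
  The two mean value expressions for the same double difference, over a small parallelogram,
  give points arbitrarily close to \<open>x\<close> at which the two mixed derivatives agree; continuity
  carries the equality to \<open>x\<close>.
\<close>

lemma mixed_derivatives_commute_real:
  fixes f :: "'a::real_normed_vector \<Rightarrow> real"
  assumes S: "open S" and x: "x \<in> S"
    and f: "\<And>y. y \<in> S \<Longrightarrow> (f has_derivative f' y) (at y)"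
    and fv: "\<And>y. y \<in> S \<Longrightarrow> ((\<lambda>y. f' y v) has_derivative fv' y) (at y)"
    and fw: "\<And>y. y \<in> S \<Longrightarrow> ((\<lambda>y. f' y w) has_derivative fw' y) (at y)"
    and cont: "continuous_on S (\<lambda>y. fv' y w)" "continuous_on S (\<lambda>y. fw' y v)"
  shows "fv' x w = fw' x v"
proof (rule ccontr)
  assume "fv' x w \<noteq> fw' x v"
  define e where "e = \<bar>fv' x w - fw' x v\<bar> / 2"
  have e: "e > 0"
    using \<open>fv' x w \<noteq> fw' x v\<close> by (simp add: e_def)
  have "isCont (\<lambda>y. fv' y w) x" "isCont (\<lambda>y. fw' y v) x"
    using cont S x by (simp_all add: continuous_on_eq_continuous_at)
  then have "((\<lambda>y. fv' y w) \<longlongrightarrow> fv' x w) (nhds x)" "((\<lambda>y. fw' y v) \<longlongrightarrow> fw' x v) (nhds x)"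
    using tendsto_at_iff_tendsto_nhds[of "\<lambda>y. fv' y w" x] tendsto_at_iff_tendsto_nhds[of "\<lambda>y. fw' y v" x]
    by (simp_all only: isCont_def)
  then have "\<forall>\<^sub>F y in nhds x. dist (fv' y w) (fv' x w) < e"
    "\<forall>\<^sub>F y in nhds x. dist (fw' y v) (fw' x v) < e"
    using e by (auto intro: tendstoD)
  moreover have "\<forall>\<^sub>F y in nhds x. y \<in> S"
    using S x by (rule eventually_nhds_in_open)
  ultimately have "\<forall>\<^sub>F y in nhds x. dist (fv' y w) (fv' x w) < e \<and> dist (fw' y v) (fw' x v) < e \<and> y \<in> S"
    by eventually_elim auto
  then obtain d where d: "d > 0" and near: "\<And>y. dist y x < d \<Longrightarrow>
      dist (fv' y w) (fv' x w) < e \<and> dist (fw' y v) (fw' x v) < e \<and> y \<in> S"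
    unfolding eventually_nhds_metric by blast
  \<comment> \<open>with this side length the whole parallelogram lies in the ball of radius \<open>d\<close> about \<open>x\<close>, even if \<open>v = w = 0\<close>\<close>
  define s where "s = d / (2 * (norm v + norm w + 1))"
  have "norm v + norm w + 1 > 0"
    by (smt (verit) norm_ge_zero)
  then have s: "s > 0" and "s * (norm v + norm w + 1) = d / 2"
    using d by (simp_all add: s_def field_simps)
  then have sd: "s * norm v + s * norm w < d"
    using d by (simp add: algebra_simps)
  have dist: "dist (x + a *\<^sub>R v + b *\<^sub>R w) x < d" if "0 \<le> a" "a \<le> s" "0 \<le> b" "b \<le> s" for a b
  proof -
    have "norm (a *\<^sub>R v + b *\<^sub>R w) \<le> a * norm v + b * norm w"
      using norm_triangle_ineq[of "a *\<^sub>R v" "b *\<^sub>R w"] that by simp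
    also have "\<dots> \<le> s * norm v + s * norm w"
      using that by (intro add_mono mult_right_mono) auto
    finally show ?thesis
      using sd by (simp add: dist_norm add.assoc)
  qed
  have dist': "dist (x + a *\<^sub>R w + b *\<^sub>R v) x < d" if "0 \<le> a" "a \<le> s" "0 \<le> b" "b \<le> s" for a b
    using dist[of b a] that by (simp add: algebra_simps)
  obtain a b where ab: "0 < a" "a < s" "0 < b" "b < s" and
    1: "f (x + s *\<^sub>R v + s *\<^sub>R w) - f (x + s *\<^sub>R v) - f (x + s *\<^sub>R w) + f x
         = s * s * fv' (x + a *\<^sub>R v + b *\<^sub>R w) w"
    using double_difference_mean_value[OF s _ f fv, where x = x and w = w] near dist by blast
  obtain a' b' where ab': "0 < a'" "a' < s" "0 < b'" "b' < s" and
    2: "f (x + s *\<^sub>R w + s *\<^sub>R v) - f (x + s *\<^sub>R w) - f (x + s *\<^sub>R v) + f x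
         = s * s * fw' (x + a' *\<^sub>R w + b' *\<^sub>R v) v"
    using double_difference_mean_value[OF s _ f fw, where x = x and w = v] near dist' by blast
  have "s * s * fv' (x + a *\<^sub>R v + b *\<^sub>R w) w = s * s * fw' (x + a' *\<^sub>R w + b' *\<^sub>R v) v"
    using 1 2 by (simp add: algebra_simps)
  then have "fv' (x + a *\<^sub>R v + b *\<^sub>R w) w = fw' (x + a' *\<^sub>R w + b' *\<^sub>R v) v"
    using s by simp
  moreover have "\<bar>fv' (x + a *\<^sub>R v + b *\<^sub>R w) w - fv' x w\<bar> < e"
    using near[OF dist[of a b]] ab by (simp add: dist_real_def)
  moreover have "\<bar>fw' (x + a' *\<^sub>R w + b' *\<^sub>R v) v - fw' x v\<bar> < e"
    using near[OF dist'[of a' b']] ab' by (simp add: dist_real_def)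
  ultimately have "\<bar>fv' x w - fw' x v\<bar> < 2 * e"
    by linarith
  then show False
    by (simp add: e_def)
qed

text \<open>
  The mean value theorem needs real values, so the real case is applied to \<open>f y \<bullet> c\<close> for every \<open>c\<close>.
\<close>

lemma mixed_derivatives_commute:
  fixes f :: "'a::real_normed_vector \<Rightarrow> 'b::real_inner"
  assumes S: "open S" and x: "x \<in> S"
    and f: "\<And>y. y \<in> S \<Longrightarrow> (f has_derivative f' y) (at y)"
    and fv: "\<And>y. y \<in> S \<Longrightarrow> ((\<lambda>y. f' y v) has_derivative fv' y) (at y)"
    and fw: "\<And>y. y \<in> S \<Longrightarrow> ((\<lambda>y. f' y w) has_derivative fw' y) (at y)"
    and cont: "continuous_on S (\<lambda>y. fv' y w)" "continuous_on S (\<lambda>y. fw' y v)"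
  shows "fv' x w = fw' x v"
proof -
  have "fv' x w \<bullet> c = fw' x v \<bullet> c" for c
    by (rule mixed_derivatives_commute_real[OF S x, where f = "\<lambda>y. f y \<bullet> c" and f' = "\<lambda>y h. f' y h \<bullet> c"
          and fv' = "\<lambda>y h. fv' y h \<bullet> c" and fw' = "\<lambda>y h. fw' y h \<bullet> c"])
       (auto intro!: has_derivative_inner_left f fv fw continuous_intros cont)
  then show ?thesis
    by (metis vector_eq_rdot)
qed

section \<open>Smooth functions on open sets\<close>

text \<open>
  Openness is essential: the derivative at a point of \<open>S\<close> sees the values on a neighbourhood.
\<close>

lemma Ck_on_cong:
  assumes "open S" and "\<And>x. x \<in> S \<Longrightarrow> f x = g x" and "Ck_on k S f"
  shows "Ck_on k S g"
  using assms(2,3)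
proof (induction k arbitrary: f g)
  case 0
  then show ?case
    using continuous_on_cong[of S S f g] by simp
next
  case (Suc k)
  have eq: "frechet_derivative f (at x) = frechet_derivative g (at x)" if "x \<in> S" for x
    using that Suc.prems \<open>open S\<close> by (intro frechet_derivative_transform_within_open) auto
  have "g differentiable at x" if "x \<in> S" for x
    using that Suc.prems \<open>open S\<close>
    by (metis Ck_on.simps(2) differentiable_def has_derivative_transform_within_open)
  moreover have "Ck_on k S (\<lambda>x. frechet_derivative g (at x) v)" for v
    by (rule Suc.IH[of "\<lambda>x. frechet_derivative f (at x) v"]) (use Suc.prems eq in auto)
  ultimately show ?case
    by simp
qed

lemma smooth_on_cong:
  assumes "open S" "\<And>x. x \<in> S \<Longrightarrow> f x = g x" "smooth_on S f"
  shows "smooth_on S g"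
  using Ck_on_cong assms unfolding smooth_on_def by metis

lemma smooth_on_has_derivative:
  assumes "smooth_on S f" "x \<in> S"
  shows "(f has_derivative frechet_derivative f (at x)) (at x)"
proof -
  have "Ck_on (Suc 0) S f"
    using assms by (simp only: smooth_on_def)
  then show ?thesis
    using assms(2) by (simp flip: frechet_derivative_works)
qed

lemma smooth_on_frechet_derivative:
  assumes "smooth_on S f"
  shows "smooth_on S (\<lambda>x. frechet_derivative f (at x) v)"
proof -
  have "Ck_on (Suc k) S f" for k
    using assms by (simp only: smooth_on_def)
  then show ?thesis
    by (simp add: smooth_on_def)
qed

lemma smooth_on_continuous_on:
  assumes "smooth_on S f"
  shows "continuous_on S f"
proof -
  have "Ck_on 0 S f"
    using assms by (simp only: smooth_on_def)
  then show ?thesis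
    by simp
qed

lemma smooth_on_frechet_derivative_commute:
  fixes f :: "'a::real_normed_vector \<Rightarrow> 'b::real_inner"
  assumes "open S" "smooth_on S f" "x \<in> S"
  shows "frechet_derivative (\<lambda>y. frechet_derivative f (at y) v) (at x) w
       = frechet_derivative (\<lambda>y. frechet_derivative f (at y) w) (at x) v"
  by (rule mixed_derivatives_commute[OF assms(1,3), of f "\<lambda>y. frechet_derivative f (at y)"])
     (use assms in \<open>auto intro!: smooth_on_has_derivative smooth_on_continuous_on
        smooth_on_frechet_derivative\<close>)

text \<open>
  For linear \<open>A\<close> the chain rule has no derivative of \<open>A\<close> left in it: the derivative of \<open>f \<circ> A\<close> in
  direction \<open>v\<close> is the derivative of \<open>f\<close> in direction \<open>A v\<close>, composed with \<open>A\<close>. The induction thus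
  stays within compositions with \<open>A\<close> and needs no product rule.
\<close>

lemma Ck_on_compose_linear:
  assumes A: "bounded_linear A" and "open S" and "Ck_on k S f"
  shows "Ck_on k (A -` S) (\<lambda>x. f (A x))"
  using assms(3)
proof (induction k arbitrary: f)
  case 0
  have "continuous_on (A -` S) A"
    using A by (rule linear_continuous_on)
  then show ?case
    using 0 by (auto intro: continuous_on_compose2)
next
  case (Suc k)
  have der: "((\<lambda>x. f (A x)) has_derivative (\<lambda>h. frechet_derivative f (at (A x)) (A h))) (at x)"
    if "A x \<in> S" for x
    using that Suc.prems A
    by (intro has_derivative_compose[of A A x UNIV f])
       (auto simp flip: frechet_derivative_works intro: bounded_linear_imp_has_derivative)
  have "open (A -` S)"
    using A \<open>open S\<close> by (simp add: continuous_open_vimage linear_continuous_at)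
  then have "Ck_on k (A -` S) (\<lambda>x. frechet_derivative (\<lambda>x. f (A x)) (at x) v)" for v
    by (rule Ck_on_cong[where f = "\<lambda>x. frechet_derivative f (at (A x)) (A v)"])
       (use Suc der[THEN frechet_derivative_at] in \<open>auto dest: fun_cong\<close>)
  then show ?case
    using der by (auto simp: differentiable_def)
qed

lemma smooth_on_compose_linear:
  assumes "bounded_linear A" "open S" "smooth_on S f"
  shows "smooth_on (A -` S) (\<lambda>x. f (A x))"
  using Ck_on_compose_linear assms unfolding smooth_on_def by metis

section \<open>Families of functions depending smoothly on a parameter\<close>

text \<open>
  The partial derivatives, but in an arbitrary direction of an arbitrary normed space: derivatives
  with respect to the parameters are taken in every direction at once, as a linear map.
\<close>

definition dir_deriv :: "'a::real_normed_vector \<Rightarrow> ('a \<Rightarrow> 'b::real_normed_vector) \<Rightarrow> 'a \<Rightarrow> 'b" where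
  "dir_deriv e f y = vector_derivative (\<lambda>t. f (y + t *\<^sub>R e)) (at 0)"

lemma partial_deriv_eq_dir_deriv: "partial_deriv j = dir_deriv (axis j 1)"
  by (simp add: fun_eq_iff partial_deriv_def dir_deriv_def)

lemma dir_deriv_eq:
  assumes "(f has_derivative f') (at y)"
  shows "dir_deriv e f y = f' e"
proof -
  have "((\<lambda>t. y + t *\<^sub>R e) has_derivative (\<lambda>t. t *\<^sub>R e)) (at 0)"
    by (auto intro!: derivative_eq_intros)
  moreover have "(f has_derivative f') (at (y + 0 *\<^sub>R e))"
    using assms by simp
  ultimately have "((\<lambda>t. f (y + t *\<^sub>R e)) has_derivative (\<lambda>t. f' (t *\<^sub>R e))) (at 0)"
    by (rule has_derivative_compose)
  then have "((\<lambda>t. f (y + t *\<^sub>R e)) has_vector_derivative f' e) (at 0)"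
    using has_derivative_linear[OF assms] by (simp add: has_vector_derivative_def linear_cmul)
  then show ?thesis
    unfolding dir_deriv_def by (rule vector_derivative_at)
qed

lemma dir_deriv_cong:
  fixes f g :: "'a::real_normed_vector \<Rightarrow> 'b::real_normed_vector"
  assumes "open S" "y \<in> S" "\<And>z. z \<in> S \<Longrightarrow> f z = g z" "f differentiable (at y)"
  shows "dir_deriv e f y = dir_deriv e g y"
proof -
  obtain f' where f': "(f has_derivative f') (at y)"
    using assms(4) by (auto simp: differentiable_def)
  then have "(g has_derivative f') (at y)"
    using assms(1-3) by (rule has_derivative_transform_within_open)
  with f' show ?thesis
    by (simp add: dir_deriv_eq)
qed

text \<open>
  The set \<open>U\<close> is required to be open because equality of two families on \<open>UNIV \<times> U\<close> must pass to
  their derivatives.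
\<close>

definition smooth_family ::
    "'y::real_normed_vector set \<Rightarrow> ('w::real_normed_vector \<Rightarrow> 'y \<Rightarrow> 'b::real_normed_vector) \<Rightarrow> bool" where
  "smooth_family U h \<longleftrightarrow> open U \<and> smooth_on (UNIV \<times> U) (\<lambda>(w, y). h w y)"

lemma smooth_family_D:
  assumes "smooth_family U h"
  shows "open U" "open (UNIV \<times> U)" "smooth_on (UNIV \<times> U) (\<lambda>(w, y). h w y)"
  using assms by (auto simp: smooth_family_def open_Times)

lemma smooth_family_partial_derivatives:
  assumes h: "smooth_family U h" and y: "y \<in> U"
  defines "F \<equiv> \<lambda>(w, y). h w y"
  shows "((\<lambda>w. h w y) has_derivative (\<lambda>e. frechet_derivative F (at (w, y)) (e, 0))) (at w)"
    and "(h w has_derivative (\<lambda>e. frechet_derivative F (at (w, y)) (0, e))) (at y)"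
proof -
  have F: "(F has_derivative frechet_derivative F (at (w, y))) (at (w, y))"
    unfolding F_def using smooth_family_D(3)[OF h] by (rule smooth_on_has_derivative) (use y in auto)
  have "((\<lambda>w. (w, y)) has_derivative (\<lambda>e. (e, 0))) (at w)"
    by (auto intro!: derivative_eq_intros)
  from has_derivative_compose[OF this F]
  show "((\<lambda>w. h w y) has_derivative (\<lambda>e. frechet_derivative F (at (w, y)) (e, 0))) (at w)"
    by (simp add: F_def)
  have "((\<lambda>y. (w, y)) has_derivative (\<lambda>e. (0, e))) (at y)"
    by (auto intro!: derivative_eq_intros)
  from has_derivative_compose[OF this F]
  show "(h w has_derivative (\<lambda>e. frechet_derivative F (at (w, y)) (0, e))) (at y)"
    by (simp add: F_def)
qed

lemma smooth_family_dir_deriv: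
  assumes "smooth_family U h" and "y \<in> U"
  shows "dir_deriv e (\<lambda>w. h w y) w = frechet_derivative (\<lambda>(w, y). h w y) (at (w, y)) (e, 0)"
    and "dir_deriv d (h w) y = frechet_derivative (\<lambda>(w, y). h w y) (at (w, y)) (0, d)"
  by (rule dir_deriv_eq[OF smooth_family_partial_derivatives(1)[OF assms]],
      rule dir_deriv_eq[OF smooth_family_partial_derivatives(2)[OF assms]])

lemma smooth_family_has_derivative_param:
  assumes "smooth_family U h" and "y \<in> U"
  shows "((\<lambda>w. h w y) has_derivative (\<lambda>e. dir_deriv e (\<lambda>w. h w y) w)) (at w)"
  using smooth_family_partial_derivatives(1)[OF assms]
  by (simp add: smooth_family_dir_deriv(1)[OF assms])

lemma smooth_family_differentiable_space:
  assumes "smooth_family U h" and "y \<in> U"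
  shows "h w differentiable (at y)"
  using smooth_family_partial_derivatives(2)[OF assms] by (auto simp: differentiable_def)

lemma smooth_family_param_deriv:
  assumes h: "smooth_family U h"
  shows "smooth_family U (\<lambda>w y. dir_deriv e (\<lambda>w. h w y) w)"
  unfolding smooth_family_def
proof
  show "smooth_on (UNIV \<times> U) (\<lambda>(w, y). dir_deriv e (\<lambda>w. h w y) w)"
    by (rule smooth_on_cong[OF smooth_family_D(2)[OF h] _
          smooth_on_frechet_derivative[OF smooth_family_D(3)[OF h], of "(e, 0)"]])
       (auto simp: smooth_family_dir_deriv(1)[OF h])
qed (use h in \<open>simp add: smooth_family_def\<close>)

lemma smooth_family_space_deriv:
  assumes h: "smooth_family U h"
  shows "smooth_family U (\<lambda>w. dir_deriv d (h w))"
  unfolding smooth_family_def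
proof
  show "smooth_on (UNIV \<times> U) (\<lambda>(w, y). dir_deriv d (h w) y)"
    by (rule smooth_on_cong[OF smooth_family_D(2)[OF h] _
          smooth_on_frechet_derivative[OF smooth_family_D(3)[OF h], of "(0, d)"]])
       (auto simp: smooth_family_dir_deriv(2)[OF h])
qed (use h in \<open>simp add: smooth_family_def\<close>)

text \<open>
  In terms of the joint function on the product space, the parameter derivative is the derivative
  in direction \<open>(e, 0)\<close> and the spatial derivative is the one in direction \<open>(0, d)\<close>.
\<close>

lemma smooth_family_derivs_commute:
  fixes h :: "'w::real_normed_vector \<Rightarrow> 'y::real_normed_vector \<Rightarrow> 'b::real_inner"
  assumes h: "smooth_family U h" and y: "y \<in> U"
  shows "dir_deriv e (\<lambda>w. dir_deriv d (h w) y) w = dir_deriv d (\<lambda>y. dir_deriv e (\<lambda>w. h w y) w) y"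
proof -
  define F where "F = (\<lambda>(w, y). h w y)"
  note D = smooth_family_D[OF h, folded F_def]
  note eq = smooth_family_dir_deriv[OF h, folded F_def]
  have mem: "(w, y) \<in> UNIV \<times> U"
    using y by simp
  have diff: "(\<lambda>z. frechet_derivative F (at z) c) differentiable (at (w, y))" for c
    using smooth_on_has_derivative[OF smooth_on_frechet_derivative[OF D(3)] mem]
    unfolding differentiable_def by blast
  have "dir_deriv e (\<lambda>w. dir_deriv d (h w) y) w
      = frechet_derivative (\<lambda>(w, y). dir_deriv d (h w) y) (at (w, y)) (e, 0)"
    by (rule smooth_family_dir_deriv(1)[OF smooth_family_space_deriv[OF h] y])
  also have "frechet_derivative (\<lambda>(w, y). dir_deriv d (h w) y) (at (w, y))
      = frechet_derivative (\<lambda>z. frechet_derivative F (at z) (0, d)) (at (w, y))"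
    by (rule frechet_derivative_transform_within_open[OF diff D(2) mem, symmetric]) (auto simp: eq)
  also have "\<dots> (e, 0) = frechet_derivative (\<lambda>z. frechet_derivative F (at z) (e, 0)) (at (w, y)) (0, d)"
    by (rule smooth_on_frechet_derivative_commute[OF D(2,3) mem])
  also have "frechet_derivative (\<lambda>z. frechet_derivative F (at z) (e, 0)) (at (w, y))
      = frechet_derivative (\<lambda>(w, y). dir_deriv e (\<lambda>w. h w y) w) (at (w, y))"
    by (rule frechet_derivative_transform_within_open[OF diff D(2) mem]) (auto simp: eq)
  also have "\<dots> (0, d) = dir_deriv d (\<lambda>y. dir_deriv e (\<lambda>w. h w y) w) y"
    by (rule smooth_family_dir_deriv(2)[OF smooth_family_param_deriv[OF h] y, symmetric])
  finally show ?thesis .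
qed

text \<open>
  The form needed for the Laplacian. The inner exchange holds only on \<open>U\<close>, so the outer spatial
  derivative is compared by locality.
\<close>

lemma smooth_family_second_derivs_commute:
  fixes h :: "'w::real_normed_vector \<Rightarrow> 'y::real_normed_vector \<Rightarrow> 'b::real_inner"
  assumes h: "smooth_family U h" and y: "y \<in> U"
  shows "dir_deriv e (\<lambda>w. dir_deriv d (dir_deriv d (h w)) y) w
       = dir_deriv d (dir_deriv d (\<lambda>y. dir_deriv e (\<lambda>w. h w y) w)) y"
proof -
  note dh = smooth_family_space_deriv[OF h]
  have "dir_deriv e (\<lambda>w. dir_deriv d (dir_deriv d (h w)) y) w
      = dir_deriv d (\<lambda>y. dir_deriv e (\<lambda>w. dir_deriv d (h w) y) w) y"
    by (rule smooth_family_derivs_commute[OF dh y])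
  also have "\<dots> = dir_deriv d (dir_deriv d (\<lambda>y. dir_deriv e (\<lambda>w. h w y) w)) y"
    by (rule dir_deriv_cong[OF smooth_family_D(1)[OF h] y])
       (auto intro: smooth_family_derivs_commute[OF h]
          smooth_family_differentiable_space[OF smooth_family_param_deriv[OF dh] y])
  finally show ?thesis .
qed

text \<open>
  This turns the two networks, with their separate parameters, into families over the joint
  parameter.
\<close>

lemma smooth_family_reparam:
  assumes "smooth_family U h" "bounded_linear A"
  shows "smooth_family U (\<lambda>w. h (A w))"
proof -
  have lin: "bounded_linear (\<lambda>(w, y). (A w, y))"
    using bounded_linear_Pair[OF bounded_linear_compose[OF assms(2) bounded_linear_fst] bounded_linear_snd]
    by (simp add: case_prod_unfold)
  have "(\<lambda>(w, y). (A w, y)) -` (UNIV \<times> U) = UNIV \<times> U"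
    by auto
  then show ?thesis
    using smooth_on_compose_linear[OF lin smooth_family_D(2,3)[OF assms(1)]] assms(1)
    by (simp add: smooth_family_def case_prod_unfold)
qed

section \<open>Linearization of the differential operators\<close>

text \<open>
  As a sum of scaled constant vectors, the gradient can be differentiated by the rules for sums and
  products.
\<close>

lemma grad_eq_sum: "grad h y = (\<Sum>j\<in>UNIV. partial_deriv j h y *\<^sub>R axis j 1)"
  by (simp add: grad_def vec_eq_iff axis_def if_distrib cong: if_cong)

lemma smooth_family_component:
  fixes h :: "'w::real_normed_vector \<Rightarrow> real^'d::finite \<Rightarrow> real^'e::finite"
  assumes h: "smooth_family U h" and y: "y \<in> U"
  shows "partial_deriv j (\<lambda>z. h w z $ c) y = partial_deriv j (h w) y $ c"
proof -
  obtain h' where h': "(h w has_derivative h') (at y)"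
    using smooth_family_differentiable_space[OF h y] by (auto simp: differentiable_def)
  then show ?thesis
    unfolding partial_deriv_eq_dir_deriv
    by (simp add: dir_deriv_eq[OF h'] dir_deriv_eq[OF bounded_linear.has_derivative[OF bounded_linear_vec_nth h']])
qed

text \<open>
  The product rule applied to \<open>(v \<cdot> \<nabla>) v\<close> gives the two convective terms of \<open>ns_linearized\<close>; the
  other terms are linear in the networks, and there only the order of differentiation changes.
\<close>

lemma ns_operator_has_derivative:
  fixes v :: "'w::real_normed_vector \<Rightarrow> real^'d::finite \<Rightarrow> real^'d"
  assumes v: "smooth_family U v" and q: "smooth_family U q" and y: "y \<in> U"
  shows "((\<lambda>w. ns_operator \<nu> (v w) (q w) y) has_derivative
     (\<lambda>e. ns_linearized \<nu> (v w) (\<lambda>z. dir_deriv e (\<lambda>w. v w z) w) y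
          + grad (\<lambda>z. dir_deriv e (\<lambda>w. q w z) w) y)) (at w)"
proof -
  note [derivative_intros] =
    smooth_family_has_derivative_param[OF v y]
    smooth_family_has_derivative_param[OF smooth_family_space_deriv[OF v] y]
    smooth_family_has_derivative_param[OF smooth_family_space_deriv[OF smooth_family_space_deriv[OF v]] y]
    smooth_family_has_derivative_param[OF smooth_family_space_deriv[OF q] y]
  note nth [derivative_intros] = bounded_linear.has_derivative[OF bounded_linear_vec_nth]
  show ?thesis
    unfolding ns_operator_def ns_linearized_def laplacian_def convect_def grad_eq_sum
      partial_deriv_eq_dir_deriv
    by (rule derivative_eq_intros refl)+
       (simp add: fun_eq_iff smooth_family_derivs_commute[OF v y] smooth_family_derivs_commute[OF q y]
          smooth_family_second_derivs_commute[OF v y] sum.distrib)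
qed

lemma divergence_has_derivative:
  fixes v :: "'w::real_normed_vector \<Rightarrow> real^'d::finite \<Rightarrow> real^'d"
  assumes v: "smooth_family U v" and y: "y \<in> U"
  shows "((\<lambda>w. divergence (v w) y) has_derivative
     (\<lambda>e. divergence (\<lambda>z. dir_deriv e (\<lambda>w. v w z) w) y)) (at w)"
proof -
  note [derivative_intros] = smooth_family_has_derivative_param[OF smooth_family_space_deriv[OF v] y]
  note nth [derivative_intros] = bounded_linear.has_derivative[OF bounded_linear_vec_nth]
  note comp = smooth_family_component[OF v y] smooth_family_component[OF smooth_family_param_deriv[OF v] y]
  show ?thesis
    unfolding divergence_def comp unfolding partial_deriv_eq_dir_deriv
    by (rule derivative_eq_intros refl)+
       (simp add: fun_eq_iff smooth_family_derivs_commute[OF v y])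
qed

section \<open>The Gauss-Newton form as a pulled-back inner product\<close>

text \<open>
  The residual with each block replaced by its linearization, with the same weights. The data
  \<open>f\<close> and \<open>gbd\<close> are independent of the parameters and so disappear.
\<close>

definition stacked_linearization ::
    "real \<Rightarrow> (real^'d::finite \<Rightarrow> real^'d) \<Rightarrow> ('n::finite \<Rightarrow> real^'d) \<Rightarrow> ('b::finite \<Rightarrow> real^'d) \<Rightarrow>
     (real^'d \<Rightarrow> real^'d) \<times> (real^'d \<Rightarrow> real) \<Rightarrow> real^(('n \<times> 'd) + 'n + ('b \<times> 'd))" where
  "stacked_linearization \<nu> v x xb = (\<lambda>(\<delta>u, \<delta>p).
      \<chi> k. case k of
        Inl (i, c) \<Rightarrow> 1 / sqrt (real CARD('n)) * ((ns_linearized \<nu> v \<delta>u (x i) + grad \<delta>p (x i)) $ c)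
      | Inr (Inl i) \<Rightarrow> 1 / sqrt (real CARD('n)) * divergence \<delta>u (x i)
      | Inr (Inr (i, c)) \<Rightarrow> 1 / sqrt (real CARD('b)) * (\<delta>u (xb i) $ c))"

lemma sum_UNIV_Plus:
  fixes f :: "'a::finite + 'b::finite \<Rightarrow> 'c::comm_monoid_add"
  shows "(\<Sum>k\<in>UNIV. f k) = (\<Sum>a\<in>UNIV. f (Inl a)) + (\<Sum>b\<in>UNIV. f (Inr b))"
  by (simp add: sum.Plus comp_def flip: UNIV_Plus_UNIV)

lemma sum_UNIV_Times:
  fixes f :: "'a::finite \<times> 'b::finite \<Rightarrow> 'c::comm_monoid_add"
  shows "(\<Sum>k\<in>UNIV. f k) = (\<Sum>a\<in>UNIV. \<Sum>b\<in>UNIV. f (a, b))"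
  by (simp add: sum.cartesian_product flip: UNIV_Times_UNIV)

text \<open>
  Each quadrature weight \<open>1 / N\<close> is split as \<open>1 / sqrt N * (1 / sqrt N)\<close>, one factor for each argument.
\<close>

lemma gauss_newton_form_eq_inner:
  "gauss_newton_form \<nu> v x xb a b
     = stacked_linearization \<nu> v x xb a \<bullet> stacked_linearization \<nu> v x xb b"
proof -
  have weight: "1 / sqrt (real m) * s * (1 / sqrt (real m) * t) = 1 / real m * (s * t)" for m s t
    by (simp add: field_simps)
  show ?thesis
    by (cases a; cases b)
       (simp only: gauss_newton_form_def stacked_linearization_def quad_inner_def prod.case
          inner_vec_def sum_UNIV_Plus sum_UNIV_Times vec_lambda_beta sum.case inner_real_def
          weight sum_distrib_left add.assoc)
qed

section \<open>Jacobian of the residual and gradient of the loss\<close>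

lemma has_derivative_vec_componentwise:
  fixes F :: "'a::real_normed_vector \<Rightarrow> real^'m::finite"
  assumes "\<And>k. ((\<lambda>w. F w $ k) has_derivative (\<lambda>e. F' e $ k)) (at w)"
  shows "(F has_derivative F') (at w)"
  by (subst has_derivative_componentwise_within)
     (use assms in \<open>auto simp: Basis_vec_def inner_axis\<close>)

lemma bounded_linear_theta_part: "bounded_linear theta_part"
  unfolding theta_part_def
  by (intro linear_conv_bounded_linear[THEN iffD1] linearI) (simp_all add: vec_eq_iff)

lemma bounded_linear_psi_part: "bounded_linear psi_part"
  unfolding psi_part_def
  by (intro linear_conv_bounded_linear[THEN iffD1] linearI) (simp_all add: vec_eq_iff)

lemma residual_has_derivative:
  fixes u :: "real^'p::finite \<Rightarrow> real^'d::finite \<Rightarrow> real^'d" and p :: "real^'q::finite \<Rightarrow> real^'d \<Rightarrow> real"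
    and x :: "'n::finite \<Rightarrow> real^'d" and xb :: "'b::finite \<Rightarrow> real^'d"
  assumes u: "smooth_family U u" and p: "smooth_family U p"
    and x: "\<And>i. x i \<in> U" and xb: "\<And>i. xb i \<in> U"
  shows "(residual \<nu> f gbd u p x xb has_derivative
     (\<lambda>e. stacked_linearization \<nu> (u (theta_part w)) x xb
        (\<lambda>y. dir_deriv e (\<lambda>w. u (theta_part w) y) w, \<lambda>y. dir_deriv e (\<lambda>w. p (psi_part w) y) w)))
     (at w)"
proof (rule has_derivative_vec_componentwise)
  fix k :: "('n \<times> 'd) + 'n + ('b \<times> 'd)"
  note v = smooth_family_reparam[OF u bounded_linear_theta_part]
  note q = smooth_family_reparam[OF p bounded_linear_psi_part]
  note nth = bounded_linear.has_derivative[OF bounded_linear_vec_nth]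
  note [derivative_intros] = ns_operator_has_derivative[OF v q x] divergence_has_derivative[OF v x]
    smooth_family_has_derivative_param[OF v xb] nth
  consider (pde) i c where "k = Inl (i, c)" | (dv) i where "k = Inr (Inl i)"
    | (bd) i c where "k = Inr (Inr (i, c))"
    by (metis surj_pair sum.exhaust)
  then show "((\<lambda>w. residual \<nu> f gbd u p x xb w $ k) has_derivative
     (\<lambda>e. stacked_linearization \<nu> (u (theta_part w)) x xb
        (\<lambda>y. dir_deriv e (\<lambda>w. u (theta_part w) y) w, \<lambda>y. dir_deriv e (\<lambda>w. p (psi_part w) y) w) $ k))
     (at w)"
  proof cases
    case pde
    then show ?thesis
      unfolding residual_def stacked_linearization_def Let_def
      by (simp only: vec_lambda_beta sum.case prod.case) (rule derivative_eq_intros refl | simp)+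
  next
    case dv
    then show ?thesis
      unfolding residual_def stacked_linearization_def Let_def
      by (simp only: vec_lambda_beta sum.case prod.case) (rule derivative_eq_intros refl | simp)+
  next
    case bd
    then show ?thesis
      unfolding residual_def stacked_linearization_def Let_def
      by (simp only: vec_lambda_beta sum.case prod.case) (rule derivative_eq_intros refl | simp)+
  qed
qed

text \<open>
  Along a coordinate line of the joint parameter one of its two parts moves along a coordinate
  line and the other stays fixed; the networks therefore agree along the whole line, not
  only to first order.
\<close>

lemma tangent_eq_dir_deriv:
  "tangent u p w k = (\<lambda>y. dir_deriv (axis k 1) (\<lambda>w. u (theta_part w) y) w,
                      \<lambda>y. dir_deriv (axis k 1) (\<lambda>w. p (psi_part w) y) w)"
proof (cases k)
  case (Inl i)
  have "theta_part (w + t *\<^sub>R axis k 1) = theta_part w + t *\<^sub>R axis i 1"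
    "psi_part (w + t *\<^sub>R axis k 1) = psi_part w" for t
    by (simp_all add: Inl theta_part_def psi_part_def vec_eq_iff axis_def)
  then show ?thesis
    by (simp add: Inl tangent_def partial_deriv_def dir_deriv_def)
next
  case (Inr j)
  have "theta_part (w + t *\<^sub>R axis k 1) = theta_part w"
    "psi_part (w + t *\<^sub>R axis k 1) = psi_part w + t *\<^sub>R axis j 1" for t
    by (simp_all add: Inr theta_part_def psi_part_def vec_eq_iff axis_def)
  then show ?thesis
    by (simp add: Inr tangent_def partial_deriv_def dir_deriv_def)
qed

lemma jacobian_nth:
  assumes "(F has_derivative F') (at w)"
  shows "jacobian F (at w) $ m $ k = F' (axis k 1) $ m"
  by (simp add: jacobian_def matrix_def frechet_derivative_at[OF assms, symmetric])

lemma grad_half_norm_squared: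
  fixes F :: "real^'k::finite \<Rightarrow> real^'m::finite"
  assumes F: "F differentiable (at w)"
  shows "grad (\<lambda>w. 1 / 2 * (norm (F w))\<^sup>2) w = transpose (jacobian F (at w)) *v F w"
proof -
  let ?F' = "frechet_derivative F (at w)"
  have F': "(F has_derivative ?F') (at w)"
    using F by (simp add: frechet_derivative_works)
  have "((\<lambda>w. 1 / 2 * (norm (F w))\<^sup>2) has_derivative (\<lambda>e. F w \<bullet> ?F' e)) (at w)"
    unfolding power2_norm_eq_inner
    by (rule derivative_eq_intros F' refl)+ (simp add: inner_commute)
  then have "grad (\<lambda>w. 1 / 2 * (norm (F w))\<^sup>2) w = (\<chi> k. F w \<bullet> ?F' (axis k 1))"
    by (simp add: grad_def partial_deriv_eq_dir_deriv dir_deriv_eq)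
  also have "\<dots> = transpose (jacobian F (at w)) *v F w"
    by (simp add: vec_eq_iff matrix_vector_mult_def transpose_def jacobian_nth[OF F'] inner_vec_def
        mult.commute)
  finally show ?thesis .
qed

theorem mainTheorem3:
  fixes \<Omega> U :: "(real^'d::finite) set"
    and \<nu> :: real
    and f gbd :: "real^'d \<Rightarrow> real^'d"
    and u :: "real^'p::finite \<Rightarrow> real^'d \<Rightarrow> real^'d"
    and p :: "real^'q::finite \<Rightarrow> real^'d \<Rightarrow> real"
    and x :: "'n::finite \<Rightarrow> real^'d"
    and xb :: "'b::finite \<Rightarrow> real^'d"
    and w :: "real^('p + 'q)"
  assumes "CARD('d) = 2 \<or> CARD('d) = 3"
    and "open \<Omega>" "connected \<Omega>" "\<Omega> \<noteq> {}" "bounded \<Omega>"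
    and "\<nu> > 0"
    and "open U" "closure \<Omega> \<subseteq> U"
    and "smooth_on (UNIV \<times> U) (\<lambda>(\<theta>, y). u \<theta> y)"
    and "smooth_on (UNIV \<times> U) (\<lambda>(\<psi>, y). p \<psi> y)"
    and "\<And>i. x i \<in> \<Omega>"
    and "\<And>i. xb i \<in> frontier \<Omega>"
  shows "let r = residual \<nu> f gbd u p x xb;
             L = loss \<nu> f gbd u p x xb;
             G = gauss_newton_gram \<nu> u p x xb w;
             J = jacobian r (at w)
         in r differentiable (at w) \<and>
            G = transpose J ** J \<and>
            moore_penrose G *v grad L w = moore_penrose (transpose J ** J) *v (transpose J *v r w)"
proof -
  define r where "r = residual \<nu> f gbd u p x xb"
  define G where "G = gauss_newton_gram \<nu> u p x xb w"
  define J where "J = jacobian r (at w)"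
  have "smooth_family U u" "smooth_family U p"
    using assms by (simp_all add: smooth_family_def)
  moreover have "x i \<in> U" "xb j \<in> U" for i j
    using assms closure_subset[of \<Omega>] by (auto simp: frontier_def)
  ultimately have r': "(r has_derivative
     (\<lambda>e. stacked_linearization \<nu> (u (theta_part w)) x xb
        (\<lambda>y. dir_deriv e (\<lambda>w. u (theta_part w) y) w, \<lambda>y. dir_deriv e (\<lambda>w. p (psi_part w) y) w)))
     (at w)"
    unfolding r_def by (rule residual_has_derivative)
  then have diff: "r differentiable (at w)"
    unfolding differentiable_def by blast
  have col: "J $ m $ k = stacked_linearization \<nu> (u (theta_part w)) x xb (tangent u p w k) $ m" for m k
    by (simp add: J_def jacobian_nth[OF r'] tangent_eq_dir_deriv)
  have G: "G = transpose J ** J"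
    by (simp add: G_def gauss_newton_gram_def gram_matrix_def vec_eq_iff gauss_newton_form_eq_inner
        matrix_matrix_mult_def transpose_def inner_vec_def col)
  have "loss \<nu> f gbd u p x xb = (\<lambda>w. 1 / 2 * (norm (r w))\<^sup>2)"
    by (simp add: fun_eq_iff loss_def r_def)
  then have "grad (loss \<nu> f gbd u p x xb) w = transpose J *v r w"
    using grad_half_norm_squared[OF diff] by (simp add: J_def)
  then show ?thesis
    using diff G unfolding Let_def r_def G_def J_def by simp
qed

end
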